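(* Let $r\ge 2$ be an integer, let $F:X\to Z$ and $G:Y\to Z$ be two $r$-to-one functions given as black boxes, with $X,Y,Z$ finite and $N=|X|=|Y|=r|Z|$, and let $k$ be an integer with $1\le k\le N/(2r)$. Then the modified quantum algorithm $\mathbf{Claw}(F,G,k)$ (defined in the context) returns a claw after an expected number of $\Theta(k)$ evaluations of $F$ and $O(\sqrt{N/(rk)})$ evaluations of $G$, and uses space $\Theta(k)$. In particular, when $k=\sqrt[3]{N/r}$ (rounded to an integer), modified $\mathbf{Claw}(F,G,k)$ evaluates $F$ and $G$ an expected number of $O(\sqrt[3]{N/r})$ times and uses space $\Theta(\sqrt[3]{N/r})$. The constants implied by $O$ and $\Theta$ are absolute (independent of $N,r,k,F,G$).
   Context: A function is $r$-to-one if every element of its image has exactly $r$ distinct preimages. A claw for $F:X\to Z$ and $G:Y\to Z$ is a pair $x\in X$, $y\in Y$ such that $F(x)=G(y)$. Model: $F$ and $G$ are given as black boxes (oracles), so the only way to obtain knowledge about them is to evaluate them at points of their domains. A quantum algorithm may evaluate them in superposition (standard quantum query model) and may use randomness; the cost measure is the number of evaluations. Space is measured with a pair $(x,F(x))$ as the unit, and refers to the memory needed to hold the table of such pairs. Subroutine $\mathbf{Grover}(H,1)$: the generalization of Grover's quantum search algorithm which, for $H:Y\to\{0,1\}$ with $N=|Y|$ and $t=|\{y\in Y: H(y)=1\}|\ge 1$, finds a $y\in Y$ with $H(y)=1$ after an expected number of $O(\sqrt{N/t})$ evaluations of $H$. Modified algorithm $\mathbf{Claw}(F,G,k)$: 1.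 Select a subset $K\subseteq X$ of cardinality $k$ such that no two elements of $K$ are mapped to the same point by $F$, by picking random elements of $X$ (keeping only elements with a new value of $F$) until $|F(K)|=k$. Construct a table $L$ of size $k$ where each item holds a distinct pair $(x,F(x))$ with $x\in K$. 2. Sort $L$ according to the second entry of each item. 3. Compute $y_0=\mathbf{Grover}(H,1)$, where $H:Y\to\{0,1\}$ is defined by $H(y)=1$ if and only if a pair $(x,G(y))$ appears in $L$ for some $x\in K$. 4. Find $(x_0,G(y_0))\in L$. 5. Output the claw $(x_0,y_0)$. In the particular case $k=\sqrt[3]{N/r}$, the hypothesis $1\le k\le N/(2r)$ is still in force. *)

theory Defs
  imports
    "HOL-Probability.SPMF"
    "HOL-Library.FuncSet"
    "HOL-Library.Countable_Set"
begin

definition r_to_one :: "nat \<Rightarrow> ('a \<Rightarrow> 'b) \<Rightarrow> 'a set \<Rightarrow> bool" where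
  "r_to_one r f A \<longleftrightarrow> (\<forall>z\<in>f ` A. card {a\<in>A. f a = z} = r)"

definition is_claw :: "'x set \<Rightarrow> 'y set \<Rightarrow> ('x \<Rightarrow> 'z) \<Rightarrow> ('y \<Rightarrow> 'z) \<Rightarrow> 'x \<times> 'y \<Rightarrow> bool" where
  "is_claw X Y F G = (\<lambda>(x, y). x \<in> X \<and> y \<in> Y \<and> F x = G y)"

text \<open>
  A basis state \<open>(y, w, b)\<close> consists of the query register \<open>y\<close>, a work register holding the bit
  string (natural number) \<open>w\<close>, and one result qubit \<open>b\<close>; a state assigns to each basis state its
  amplitude.
  A classical reversible map \<open>\<pi>\<close> on basis states acts on states by \<open>\<psi> \<mapsto> \<psi> \<circ> inv \<pi>\<close>; all maps
  used below are involutions, so that \<open>inv \<pi> = \<pi>\<close>.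

  A counted state pairs a state with the number of oracle evaluations made so far, so that an
  evaluation in superposition is a map on counted states that increments the counter.
\<close>

type_synonym 'y qstate = "'y \<times> nat \<times> bool \<Rightarrow> complex"

type_synonym 'y counted = "'y qstate \<times> nat"

text \<open>The elements of the finite set \<open>Z\<close> are written in binary as \<open>0, \<dots>, card Z - 1\<close>.\<close>

abbreviation code :: "'z set \<Rightarrow> 'z \<Rightarrow> nat" where
  "code Z \<equiv> to_nat_on Z"

definition width :: "'z set \<Rightarrow> nat" where
  "width Z = (LEAST n. card Z \<le> 2 ^ n)"

text \<open>The standard oracle: \<open>|y, w, b\<rangle> \<mapsto> |y, w \<oplus> G(y), b\<rangle>\<close>.\<close>

definition query_G :: "'z set \<Rightarrow> ('y \<Rightarrow> 'z) \<Rightarrow> 'y counted \<Rightarrow> 'y counted" where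
  "query_G Z G = (\<lambda>(\<psi>, n). ((\<lambda>(y, w, b). \<psi> (y, xor w (code Z (G y)), b)), Suc n))"

text \<open>Table lookup, without any evaluation: the result qubit is flipped iff the work register holds
  a second entry of the table.\<close>

definition lookup :: "'z set \<Rightarrow> ('x \<times> 'z) list \<Rightarrow> 'y counted \<Rightarrow> 'y counted" where
  "lookup Z L = (\<lambda>(\<psi>, n).
     ((\<lambda>(y, w, b). \<psi> (y, w, b \<noteq> (w \<in> code Z ` snd ` set L))), n))"

text \<open>
  Evaluation of \<open>H\<close> in superposition, where \<open>H y\<close> says that \<open>G y\<close> is a second entry of \<open>L\<close>. The work
  register, initially zero, has to be restored by a second evaluation of \<open>G\<close>. The result is
  \<open>|y, 0, b\<rangle> \<mapsto> |y, 0, b \<oplus> H(y)\<rangle>\<close>.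
\<close>

definition query_H :: "'z set \<Rightarrow> ('y \<Rightarrow> 'z) \<Rightarrow> ('x \<times> 'z) list \<Rightarrow> 'y counted \<Rightarrow> 'y counted" where
  "query_H Z G L = query_G Z G \<circ> lookup Z L \<circ> query_G Z G"

definition eval_H :: "('y \<Rightarrow> 'z) \<Rightarrow> ('x \<times> 'z) list \<Rightarrow> 'y \<Rightarrow> nat \<Rightarrow> bool \<times> nat" where
  "eval_H G L y n = (G y \<in> snd ` set L, Suc n)"

text \<open>The result qubit starts as \<open>(|0\<rangle> - |1\<rangle>) / sqrt 2\<close>, so that flipping it for the solutions of \<open>H\<close>
  amounts to a sign change of their amplitudes.\<close>

definition init_state :: "'y set \<Rightarrow> 'y qstate" where
  "init_state Y = (\<lambda>(y, w, b).
     if y \<in> Y \<and> w = 0 then (if b then - 1 else 1) / of_real (sqrt (2 * real (card Y))) else 0)"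

definition diffusion :: "'y set \<Rightarrow> 'y counted \<Rightarrow> 'y counted" where
  "diffusion Y = (\<lambda>(\<psi>, n).
     ((\<lambda>(y, w, b). if y \<in> Y
        then 2 * (\<Sum>y'\<in>Y. \<psi> (y', w, b)) / of_nat (card Y) - \<psi> (y, w, b)
        else \<psi> (y, w, b)), n))"

text \<open>Measurement of the query register, where the work register has \<open>s\<close> qubits.\<close>

definition measure_query :: "nat \<Rightarrow> 'y qstate \<Rightarrow> 'y spmf" where
  "measure_query s \<psi> = embed_spmf (\<lambda>y. \<Sum>w<2 ^ s. \<Sum>b\<in>UNIV. (cmod (\<psi> (y, w, b)))\<^sup>2)"

definition grover_run ::
  "'y set \<Rightarrow> nat \<Rightarrow> ('y counted \<Rightarrow> 'y counted) \<Rightarrow> nat \<Rightarrow> nat \<Rightarrow> ('y \<times> nat) spmf" where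
  "grover_run Y s qH j n =
     (case ((diffusion Y \<circ> qH) ^^ j) (init_state Y, n) of
        (\<psi>, n') \<Rightarrow> map_spmf (\<lambda>y. (y, n')) (measure_query s \<psi>))"

text \<open>
  Search for an unknown number of solutions (Boyer, Brassard, Hoyer, Tapp): run \<open>j\<close> Grover
  iterations for a random \<open>j < m\<close>, measure, and test the result classically; on failure continue
  with \<open>m\<close> increased by the factor \<open>6/5\<close>, up to the square root of the size of \<open>Y\<close>. The arguments
  \<open>qH\<close> and \<open>cH\<close> evaluate \<open>H\<close> in superposition and classically, and \<open>n\<close> counts evaluations.
\<close>

partial_function (spmf) grover_loop ::
  "'y set \<Rightarrow> nat \<Rightarrow> ('y counted \<Rightarrow> 'y counted) \<Rightarrow> ('y \<Rightarrow> nat \<Rightarrow> bool \<times> nat) \<Rightarrow> real \<Rightarrow> nat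
    \<Rightarrow> ('y \<times> nat) spmf" where
  "grover_loop Y s qH cH m n =
     bind_spmf (spmf_of_set {j. real j < m}) (\<lambda>j.
     bind_spmf (grover_run Y s qH j n) (\<lambda>(y, n').
     case cH y n' of (success, n'') \<Rightarrow>
       if success then return_spmf (y, n'')
       else grover_loop Y s qH cH (min (6 / 5 * m) (sqrt (real (card Y)))) n''))"

definition grover ::
  "'y set \<Rightarrow> nat \<Rightarrow> ('y counted \<Rightarrow> 'y counted) \<Rightarrow> ('y \<Rightarrow> nat \<Rightarrow> bool \<times> nat)
    \<Rightarrow> ('y \<times> nat) spmf" where
  "grover Y s qH cH = grover_loop Y s qH cH 1 0"

text \<open>
  Extend the table \<open>L\<close> until it has \<open>k\<close> different second entries. The counter \<open>n\<close> is the number of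
  evaluations of \<open>F\<close>, and \<open>s\<close> the largest number of pairs held in the table so far.
\<close>

partial_function (spmf) build_table ::
  "'x set \<Rightarrow> ('x \<Rightarrow> 'z) \<Rightarrow> nat \<Rightarrow> ('x \<times> 'z) list \<Rightarrow> nat \<Rightarrow> nat
    \<Rightarrow> (('x \<times> 'z) list \<times> nat \<times> nat) spmf" where
  "build_table X F k L n s =
     (if card (snd ` set L) = k then return_spmf (L, n, s)
      else bind_spmf (spmf_of_set X) (\<lambda>x.
        let z = F x in
        if z \<in> snd ` set L then build_table X F k L (Suc n) s
        else build_table X F k ((x, z) # L) (Suc n) (max s (length ((x, z) # L)))))"

datatype ('x, 'y) outcome =
  Outcome (claw: "'x \<times> 'y") (evals_F: nat) (evals_G: nat) (table_space: nat)

definition Claw ::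
  "'x set \<Rightarrow> 'y set \<Rightarrow> 'z set \<Rightarrow> ('x \<Rightarrow> 'z) \<Rightarrow> ('y \<Rightarrow> 'z) \<Rightarrow> nat \<Rightarrow> ('x, 'y) outcome spmf" where
  "Claw X Y Z F G k =
     bind_spmf (build_table X F k [] 0 0) (\<lambda>(L\<^sub>0, nF, s).
     let L = sort_key (\<lambda>p. code Z (snd p)) L\<^sub>0 in
     bind_spmf (grover Y (width Z) (query_H Z G L) (eval_H G L)) (\<lambda>(y\<^sub>0, nG).
     let z = G y\<^sub>0 in
     case find (\<lambda>p. snd p = z) L of
       None \<Rightarrow> return_pmf None
     | Some (x\<^sub>0, _) \<Rightarrow> return_spmf (Outcome (x\<^sub>0, y\<^sub>0) nF (Suc nG) s)))"

definition expected :: "'a spmf \<Rightarrow> ('a \<Rightarrow> nat) \<Rightarrow> ennreal" where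
  "expected p f = (\<integral>\<^sup>+ a. of_nat (f a) \<partial>measure_spmf p)"

end

theory Submission
  imports Defs
begin

text \<open>
  Both functions are onto \<open>Z\<close>. While the table has fewer than \<open>k \<le> card Z / 2\<close> entries, a random
  element of \<open>X\<close> extends it with probability at least \<open>1/2\<close>, so at most \<open>2 * k\<close> evaluations of \<open>F\<close>
  are expected. The search has \<open>t = r * k\<close> solutions among \<open>N\<close> elements. With \<open>sin\<^sup>2 \<theta> = t / N\<close>, a
  measurement after \<open>j\<close> Grover iterations gives a solution with probability \<open>sin\<^sup>2 ((2 * j + 1) * \<theta>)\<close>;
  averaged over \<open>j < M\<close> this is at least \<open>1/4\<close> as soon as \<open>M \<ge> 1 / sin (2 * \<theta>)\<close>, and
  \<open>1 / sin (2 * \<theta>) \<le> sqrt (N / (2 * t))\<close> because \<open>t \<le> N / 2\<close>. Upper bounds on expected costs of the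
  loops hold for the least fixed point by fixed-point induction with a potential function;
  the loops end almost surely because a round succeeds with a probability bounded away from 0.
\<close>

section \<open>Loops of subprobability mass functions\<close>

lemma nn_integral_bind_spmf:
  "(\<integral>\<^sup>+ y. f y \<partial>measure_spmf (bind_spmf p g)) = (\<integral>\<^sup>+ x. \<integral>\<^sup>+ y. f y \<partial>measure_spmf (g x) \<partial>measure_spmf p)"
  unfolding measure_spmf_bind
  by (subst nn_integral_bind[where B = "count_space UNIV"])
     (auto simp: measurable_cong_sets[OF sets_measure_spmf refl] space_subprob_algebra o_def)

lemma nn_integral_return_spmf: "(\<integral>\<^sup>+ y. f y \<partial>measure_spmf (return_spmf x)) = f x"
  by (simp add: measure_spmf_return_spmf nn_integral_return)

text \<open>Monotone convergence for a chain that may be uncountable: the least upper bound has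
  countable support, and on a countable space the integral commutes with suprema of chains of
  functions.\<close>

lemma nn_integral_lub_spmf:
  assumes chain: "Complete_Partial_Order.chain (ord_spmf (=)) Y" and Y: "Y \<noteq> {}"
  shows "(\<integral>\<^sup>+ x. f x \<partial>measure_spmf (lub_spmf Y)) = (SUP p\<in>Y. \<integral>\<^sup>+ x. f x \<partial>measure_spmf p)"
proof -
  let ?M = "count_space (set_spmf (lub_spmf Y))"
  have "(\<integral>\<^sup>+ x. f x \<partial>measure_spmf (lub_spmf Y)) = (\<integral>\<^sup>+ x. (SUP p\<in>Y. ennreal (spmf p x) * f x) \<partial>?M)"
    by (simp add: nn_integral_measure_spmf' ennreal_spmf_lub_spmf[OF chain Y] SUP_mult_right_ennreal)
  also have "\<dots> = (SUP p\<in>Y. \<integral>\<^sup>+ x. ennreal (spmf p x) * f x \<partial>?M)"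
  proof (rule nn_integral_monotone_convergence_SUP_countable)
    have "(\<lambda>p x. ennreal (spmf p x) * f x) ` Y = (\<lambda>g x. g x * f x) ` (\<lambda>p x. ennreal (spmf p x)) ` Y"
      by (simp add: image_image)
    also have "Complete_Partial_Order.chain (\<le>) \<dots>" using chain_ord_spmf_eqD[OF chain]
      by (rule chain_imageI) (auto simp: le_fun_def intro: mult_right_mono)
    finally show "Complete_Partial_Order.chain (\<le>) ((\<lambda>p x. ennreal (spmf p x) * f x) ` Y)" .
  qed (use Y in simp_all)
  also have "\<dots> = (SUP p\<in>Y. \<integral>\<^sup>+ x. ennreal (spmf p x) * f x \<partial>count_space UNIV)"
    by (auto simp: nn_integral_count_space_indicator set_lub_spmf[OF chain] spmf_eq_0_set_spmf
        split: split_indicator intro!: arg_cong [of _ _ Sup] image_cong nn_integral_cong)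
  finally show ?thesis
    by (simp add: nn_integral_measure_spmf)
qed

text \<open>Continuity makes upper bounds on expectations admissible, so that fixed-point induction
  can prove them for recursive programs.\<close>

lemma mcont_nn_integral_spmf:
  "mcont lub_spmf (ord_spmf (=)) Sup (\<le>) (\<lambda>p. \<integral>\<^sup>+ x. f x \<partial>measure_spmf p)"
proof (rule mcontI)
  show "monotone (ord_spmf (=)) (\<le>) (\<lambda>p. \<integral>\<^sup>+ x. f x \<partial>measure_spmf p)"
    by (rule monotoneI)
       (auto simp: nn_integral_measure_spmf dest: ord_spmf_eq_leD
         intro!: nn_integral_mono mult_right_mono ennreal_leI)
  show "cont lub_spmf (ord_spmf (=)) Sup (\<le>) (\<lambda>p. \<integral>\<^sup>+ x. f x \<partial>measure_spmf p)"
    by (rule contI) (rule nn_integral_lub_spmf)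
qed

lemmas mcont2mcont_nn_integral_spmf [cont_intro] = mcont_nn_integral_spmf[THEN mcont2mcont]

lemma nn_integral_spmf_le_const:
  assumes "\<And>x. x \<in> set_spmf p \<Longrightarrow> f x \<le> c"
  shows "(\<integral>\<^sup>+ x. f x \<partial>measure_spmf p) \<le> c"
proof -
  have "(\<integral>\<^sup>+ x. f x \<partial>measure_spmf p) \<le> (\<integral>\<^sup>+ x. c \<partial>measure_spmf p)"
    by (rule nn_integral_mono_AE) (simp add: assms)
  also have "\<dots> \<le> c * 1"
    using mult_left_mono[OF measure_spmf.emeasure_space_le_1[of p], of c] by simp
  finally show ?thesis by simp
qed

lemma nn_integral_lossless_spmf_ge_const:
  assumes "lossless_spmf p" "\<And>x. x \<in> set_spmf p \<Longrightarrow> c \<le> f x"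
  shows "c \<le> (\<integral>\<^sup>+ x. f x \<partial>measure_spmf p)"
proof -
  have "c = (\<integral>\<^sup>+ x. c \<partial>measure_spmf p)"
    using assms(1) by (simp add: space_measure_spmf lossless_spmf_def measure_spmf.emeasure_eq_measure weight_spmf_def)
  also have "\<dots> \<le> (\<integral>\<^sup>+ x. f x \<partial>measure_spmf p)"
    by (rule nn_integral_mono_AE) (simp add: assms)
  finally show ?thesis .
qed

text \<open>\<open>A\<close> serves as the bad event of a round, a collision or a failed test. As
  \<open>a \<le> b\<close>, raising its probability to \<open>q\<close> only enlarges the
  bound.\<close>

lemma nn_integral_spmf_le_two_values:
  assumes f: "\<And>x. x \<in> set_spmf p \<Longrightarrow> f x \<le> ennreal (if x \<in> A then b else a)"
    and A: "measure (measure_spmf p) A \<le> q" and ab: "0 \<le> a" "a \<le> b"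
  shows "(\<integral>\<^sup>+ x. f x \<partial>measure_spmf p) \<le> ennreal (a + (b - a) * q)"
proof -
  have q: "0 \<le> q" using A measure_nonneg order_trans by blast
  have "(\<integral>\<^sup>+ x. f x \<partial>measure_spmf p)
      \<le> (\<integral>\<^sup>+ x. (ennreal a + ennreal (b - a) * indicator A x) \<partial>measure_spmf p)"
    using ab by (intro nn_integral_mono_AE)
      (auto intro!: order_trans[OF f] simp: ennreal_plus[symmetric] simp del: ennreal_plus)
  also have "\<dots> = (\<integral>\<^sup>+ x. ennreal a \<partial>measure_spmf p) + ennreal (b - a) * emeasure (measure_spmf p) A"
    by (subst nn_integral_add) (simp_all add: nn_integral_cmult)
  also have "\<dots> \<le> ennreal a + ennreal (b - a) * ennreal q"
    using A by (intro add_mono mult_left_mono nn_integral_spmf_le_const)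
      (simp_all add: measure_spmf.emeasure_eq_measure ennreal_leI)
  also have "\<dots> = ennreal (a + (b - a) * q)"
    using ab q by (simp add: ennreal_mult[symmetric] ennreal_plus[symmetric] del: ennreal_plus)
  finally show ?thesis .
qed

text \<open>The infimum \<open>w\<close> of the weights of the loops satisfies \<open>w \<ge> w + (1 - w) * p\<close>.\<close>

lemma lossless_spmf_loop:
  fixes loop :: "'s \<Rightarrow> 'a spmf"
  assumes step: "\<And>s. I s \<Longrightarrow> \<exists>(rnd :: 'b spmf) g A. loop s = bind_spmf rnd g \<and> lossless_spmf rnd \<and>
      p \<le> measure (measure_spmf rnd) A \<and>
      (\<forall>x\<in>set_spmf rnd. if x \<in> A then lossless_spmf (g x) else \<exists>s'. I s' \<and> g x = loop s')"
    and p: "0 < p" and s: "I s"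
  shows "lossless_spmf (loop s)"
proof -
  define w where "w = (INF s\<in>{s. I s}. weight_spmf (loop s))"
  have w_le: "w \<le> weight_spmf (loop s)" if "I s" for s
    unfolding w_def using that by (intro cINF_lower) (auto intro!: bdd_belowI2 weight_spmf_nonneg)
  have w1: "w \<le> 1" using w_le[OF s] weight_spmf_le_1[of "loop s"] by linarith
  have "w + (1 - w) * p \<le> weight_spmf (loop s)" if "I s" for s
  proof -
    obtain rnd :: "'b spmf" and g A where rnd: "loop s = bind_spmf rnd g" "lossless_spmf rnd"
      "p \<le> measure (measure_spmf rnd) A"
      "\<And>x. x \<in> set_spmf rnd \<Longrightarrow> if x \<in> A then lossless_spmf (g x) else \<exists>s'. I s' \<and> g x = loop s'"
      using step[OF \<open>I s\<close>] by metis
    have "w + (1 - w) * p \<le> w * weight_spmf rnd + (1 - w) * measure (measure_spmf rnd) A"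
      using rnd(2,3) w1 by (intro add_mono mult_left_mono) (auto simp: lossless_spmf_def)
    also have "\<dots> = (\<integral>x. w + (1 - w) * indicator A x \<partial>measure_spmf rnd)"
      by (subst Bochner_Integration.integral_add)
         (simp_all add: weight_spmf_def integrable_mult_right_iff measure_spmf.integrable_const_bound[where B = 1])
    also have "\<dots> \<le> (\<integral>x. weight_spmf (g x) \<partial>measure_spmf rnd)"
    proof (rule integral_mono_AE)
      show "integrable (measure_spmf rnd) (\<lambda>x. w + (1 - w) * indicator A x)"
        by (intro Bochner_Integration.integrable_add integrable_mult_right)
           (simp_all add: measure_spmf.integrable_const_bound[where B = 1])
      show "integrable (measure_spmf rnd) (\<lambda>x. weight_spmf (g x))"
        by (rule measure_spmf.integrable_const_bound[where B = 1])
           (simp_all add: weight_spmf_le_1 weight_spmf_nonneg)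
      \<comment> \<open>On \<open>A\<close> the continuation has weight
        \<open>1 = w + (1 - w)\<close>; off \<open>A\<close> it is the loop in another state
        satisfying \<open>I\<close>, of weight at least \<open>w\<close>.\<close>
      show "AE x in measure_spmf rnd. w + (1 - w) * indicator A x \<le> weight_spmf (g x)"
      proof (simp, intro ballI)
        fix x assume "x \<in> set_spmf rnd"
        from rnd(4)[OF this] show "w + (1 - w) * indicator A x \<le> weight_spmf (g x)"
          by (auto split: if_splits simp: lossless_weight_spmfD intro: w_le)
      qed
    qed
    finally show ?thesis by (simp add: rnd(1) weight_bind_spmf o_def)
  qed
  \<comment> \<open>Infimum over all states satisfying \<open>I\<close>; only the right-hand
    \<open>w\<close> is unfolded. What remains is \<open>(1 - w) * p \<le> 0\<close>.\<close>
  then have "w + (1 - w) * p \<le> w"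
    by (subst (3) w_def) (intro cINF_greatest, use s in auto)
  then have "1 \<le> w" using p by (simp add: mult_le_0_iff)
  then show ?thesis using w_le[OF s] weight_spmf_le_1[of "loop s"] by (simp add: lossless_spmf_def)
qed

section \<open>Building the table\<close>

text \<open>The preimage of \<open>S\<close> is the disjoint union of the fibres over
  \<open>S\<close>, each of size \<open>r\<close>.\<close>

lemma r_to_one_card_vimage:
  assumes "r_to_one r f A" "finite A" "S \<subseteq> f ` A"
  shows "card {a\<in>A. f a \<in> S} = r * card S"
proof -
  have "{a\<in>A. f a \<in> S} = (\<Union>z\<in>S. {a\<in>A. f a = z})" by auto
  also have "card \<dots> = (\<Sum>z\<in>S. card {a\<in>A. f a = z})"
    using assms by (intro card_UN_disjoint) (auto intro: finite_subset)
  also have "\<dots> = (\<Sum>z\<in>S. r)"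
    using assms by (intro sum.cong) (auto simp: r_to_one_def)
  finally show ?thesis by simp
qed

text \<open>Counting \<open>A\<close> by fibres shows that the image has as many elements as
  \<open>B\<close>. Surjectivity of \<open>G\<close> ensures that every table entry is hit by points
  of \<open>Y\<close>.\<close>

lemma r_to_one_image_eq:
  assumes "r_to_one r f A" "finite A" "finite B" "f \<in> A \<rightarrow> B" "card A = r * card B" "0 < r"
  shows "f ` A = B"
proof (rule card_subset_eq)
  have "{a\<in>A. f a \<in> f ` A} = A" by auto
  then have "r * card (f ` A) = r * card B"
    using r_to_one_card_vimage[OF assms(1,2) order_refl] assms(5) by auto
  then show "card (f ` A) = card B" using assms(6) by auto
qed (use assms in auto)

text \<open>Invariant of \<open>build_table\<close>. Distinct second entries make the length of the
  table equal to the number of values that the stopping test counts.\<close>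

definition valid_table :: "'x set \<Rightarrow> ('x \<Rightarrow> 'z) \<Rightarrow> ('x \<times> 'z) list \<Rightarrow> bool" where
  "valid_table X F L \<longleftrightarrow> distinct (map snd L) \<and> set L \<subseteq> (\<lambda>x. (x, F x)) ` X"

lemma valid_table_Nil: "valid_table X F []"
  by (simp add: valid_table_def)

lemma valid_table_Cons:
  assumes "valid_table X F L" "x \<in> X" "F x \<notin> snd ` set L"
  shows "valid_table X F ((x, F x) # L)"
  using assms by (auto simp: valid_table_def)

lemma valid_table_card: "valid_table X F L \<Longrightarrow> card (snd ` set L) = length L"
  by (metis distinct_card length_map set_map valid_table_def)

lemma valid_table_snd_subset: "valid_table X F L \<Longrightarrow> snd ` set L \<subseteq> F ` X"
  by (auto simp: valid_table_def)

text \<open>Each new entry costs at least one evaluation, so at least \<open>k - length L\<close>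
  are added to \<open>n\<close>; the inequality is written without subtraction. From the empty table
  it yields the lower bound \<open>k\<close> on the evaluations of \<open>F\<close>.\<close>

lemma set_build_table:
  "valid_table X F L \<Longrightarrow> s = length L \<Longrightarrow> length L \<le> k \<Longrightarrow> finite X \<Longrightarrow>
    set_spmf (build_table X F k L n s)
      \<subseteq> {(L', n', s'). valid_table X F L' \<and> length L' = k \<and> s' = k \<and> n + k \<le> n' + length L}"
proof (induction arbitrary: X F k L n s rule: build_table.fixp_induct)
  case 1
  show ?case by simp
next
  case 2
  show ?case by simp
next
  case (3 bt)
  show ?case
  proof (cases "length L = k")
    case True
    then show ?thesis using 3(2-) by (simp add: valid_table_card)
  next
    case False
    note card = valid_table_card[OF 3(2)]
    have "set_spmf (let z = F x in if z \<in> snd ` set L then bt X F k L (Suc n) s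
        else bt X F k ((x, z) # L) (Suc n) (max s (length ((x, z) # L))))
      \<subseteq> {(L', n', s'). valid_table X F L' \<and> length L' = k \<and> s' = k \<and> n + k \<le> n' + length L}"
      if x: "x \<in> X" for x
    proof (cases "F x \<in> snd ` set L")
      case True
      then show ?thesis using 3(1)[OF 3(2-5), of "Suc n"] by (auto simp: Let_def)
    next
      case new: False
      have "set_spmf (bt X F k ((x, F x) # L) (Suc n) (length ((x, F x) # L)))
        \<subseteq> {(L', n', s'). valid_table X F L' \<and> length L' = k \<and> s' = k
             \<and> Suc n + k \<le> n' + length ((x, F x) # L)}"
        using False 3(4,5) by (intro 3(1) valid_table_Cons[OF 3(2) x new]) auto
      then show ?thesis
        using new 3(3) by (auto simp: Let_def max_def)
    qed
    then have "(\<Union>x\<in>X. set_spmf (let z = F x in if z \<in> snd ` set L then bt X F k L (Suc n) s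
        else bt X F k ((x, z) # L) (Suc n) (max s (length ((x, z) # L)))))
      \<subseteq> {(L', n', s'). valid_table X F L' \<and> length L' = k \<and> s' = k \<and> n + k \<le> n' + length L}"
      by (rule UN_least)
    then show ?thesis
      using False 3(5) by (simp only: card set_bind_spmf if_False set_spmf_of_set_finite bind_UNION o_def)
  qed
qed

text \<open>Stored values and image values all have \<open>r\<close> preimages, so the factor
  \<open>r\<close> cancels in the quotient.\<close>

lemma measure_collision:
  assumes "finite X" "r_to_one r F X" "0 < r" "valid_table X F L"
  shows "measure (measure_spmf (spmf_of_set X)) {x. F x \<in> snd ` set L} = length L / card (F ` X)"
proof -
  have "{x\<in>X. F x \<in> F ` X} = X" by auto
  then have "card X = r * card (F ` X)"
    using r_to_one_card_vimage[OF assms(2,1) order_refl] by simp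
  moreover have "X \<inter> {x. F x \<in> snd ` set L} = {x\<in>X. F x \<in> snd ` set L}" by auto
  ultimately show ?thesis
    using r_to_one_card_vimage[OF assms(2,1) valid_table_snd_subset[OF assms(4)]] assms(3)
    by (simp add: measure_spmf_of_set valid_table_card[OF assms(4)])
qed

text \<open>A new value needs at most 2 expected tries, whence the potential
  \<open>n + 2 * (k - length L)\<close>.\<close>

lemma build_table_evals_le:
  "valid_table X F L \<Longrightarrow> length L \<le> k \<Longrightarrow>
    finite X \<Longrightarrow> r_to_one r F X \<Longrightarrow> 0 < r \<Longrightarrow> 2 * k \<le> card (F ` X) \<Longrightarrow>
    (\<integral>\<^sup>+ (L', n', s'). of_nat n' \<partial>measure_spmf (build_table X F k L n s))
      \<le> ennreal (real n + 2 * real (k - length L))"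
proof (induction arbitrary: X F k L n s rule: build_table.fixp_induct)
  case 1
  show ?case by simp
next
  case 2
  show ?case by simp
next
  case (3 bt)
  note card = valid_table_card[OF 3(2)]
  show ?case
  proof (cases "length L = k")
    case True
    then show ?thesis
      by (simp add: card nn_integral_return_spmf ennreal_of_nat_eq_real_of_nat)
  next
    case False
    define l where "l = length L"
    have l: "l < k" using False 3(3) by (simp add: l_def)
    \<comment> \<open>\<open>?b\<close> is the bound after a collision, \<open>?a\<close> the bound
      after a new entry. They differ by 2, so with collision probability at most 1/2 the mean is at
      most \<open>?a + 1\<close>, the old potential.\<close>
    let ?b = "real (Suc n) + 2 * real (k - l)" and ?a = "real (Suc n) + 2 * real (k - Suc l)"
    let ?step = "\<lambda>x. let z = F x in if z \<in> snd ` set L then bt X F k L (Suc n) s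
        else bt X F k ((x, z) # L) (Suc n) (max s (length ((x, z) # L)))"
    have "(\<integral>\<^sup>+ x. (\<integral>\<^sup>+ (L', n', s'). of_nat n' \<partial>measure_spmf (?step x)) \<partial>measure_spmf (spmf_of_set X))
      \<le> ennreal (?a + (?b - ?a) * (1 / 2))"
    proof (rule nn_integral_spmf_le_two_values[where A = "{x. F x \<in> snd ` set L}"])
      fix x assume "x \<in> set_spmf (spmf_of_set X)"
      then have x: "x \<in> X" using 3(4) by simp
      show "(\<integral>\<^sup>+ (L', n', s'). of_nat n' \<partial>measure_spmf (?step x))
        \<le> ennreal (if x \<in> {x. F x \<in> snd ` set L} then ?b else ?a)"
      proof (cases "F x \<in> snd ` set L")
        case True
        then show ?thesis using 3(1)[OF 3(2-7), of "Suc n" s] by (simp add: Let_def l_def)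
      next
        case new: False
        then show ?thesis
          using 3(1)[OF valid_table_Cons[OF 3(2) x new] _ 3(4-7), of "Suc n" "max s (Suc l)"] l
          by (simp add: Let_def l_def)
      qed
    next
      have "real l / real (card (F ` X)) \<le> 1 / 2"
        using l 3(7) by (simp add: field_simps flip: of_nat_mult)
      then show "measure (measure_spmf (spmf_of_set X)) {x. F x \<in> snd ` set L} \<le> 1 / 2"
        by (simp add: measure_collision[OF 3(4,5,6,2)] l_def)
    qed auto
    also have "?a + (?b - ?a) * (1 / 2) = real n + 2 * real (k - l)"
      using l by (simp add: of_nat_diff)
    finally show ?thesis
      using False by (simp add: card nn_integral_bind_spmf l_def)
  qed
qed

text \<open>Induction on the number of missing entries. With the table fixed, repeated collisions
  form a loop whose state is the pair of counters \<open>(n, s)\<close>; a new value, of probability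
  at least 1/2, leaves it for a call covered by the induction hypothesis.\<close>

lemma lossless_build_table:
  fixes X :: "'x set"
  assumes "finite X" "r_to_one r F X" "0 < r" "2 * k \<le> card (F ` X)"
    and "valid_table X F L" "length L \<le> k"
  shows "lossless_spmf (build_table X F k L n s)"
  using assms(5,6)
proof (induction "k - length L" arbitrary: L n s)
  case 0
  then show ?case by (simp add: build_table.simps valid_table_card)
next
  case (Suc d)
  note card = valid_table_card[OF Suc.prems(1)]
  have less: "length L < k" using Suc.hyps(2) by simp
  have X: "X \<noteq> {}" using less assms(4) by auto
  let ?loop = "\<lambda>(n, s). build_table X F k L n s"
  have "lossless_spmf (?loop (n, s))"
  proof (rule lossless_spmf_loop[where 'b = 'x and loop = ?loop and I = "\<lambda>_. True" and p = "1 / 2"], goal_cases)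
    case (1 ns)
    obtain n s where ns: "ns = (n, s)" by force
    let ?A = "- {x. F x \<in> snd ` set L}"
    let ?step = "\<lambda>x. let z = F x in if z \<in> snd ` set L then build_table X F k L (Suc n) s
        else build_table X F k ((x, z) # L) (Suc n) (max s (length ((x, z) # L)))"
    have "measure (measure_spmf (spmf_of_set X)) ?A
        = 1 - measure (measure_spmf (spmf_of_set X)) {x. F x \<in> snd ` set L}"
      using assms(1) X
      by (simp add: measure_spmf_spmf_of_set measure_pmf.prob_compl[simplified, symmetric] Compl_eq_Diff_UNIV)
    moreover have "measure (measure_spmf (spmf_of_set X)) {x. F x \<in> snd ` set L} \<le> 1 / 2"
      using less assms(4)
      by (subst measure_collision[OF assms(1,2,3) Suc.prems(1)]) (simp add: field_simps flip: of_nat_mult)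
    ultimately have prob: "1 / 2 \<le> measure (measure_spmf (spmf_of_set X)) ?A" by simp
    have unfold: "?loop ns = bind_spmf (spmf_of_set X) ?step"
      using less by (simp add: ns build_table.simps[of X F k L] card)
    have step: "if x \<in> ?A then lossless_spmf (?step x)
        else \<exists>s'. True \<and> ?step x = ?loop s'" if "x \<in> X" for x
    proof (cases "F x \<in> snd ` set L")
      case True
      then show ?thesis by (auto simp: Let_def intro!: exI[of _ "(Suc n, s)"])
    next
      case False
      have "lossless_spmf (build_table X F k ((x, F x) # L) (Suc n) (max s (length ((x, F x) # L))))"
        using less Suc.hyps(2) by (intro Suc.hyps(1) valid_table_Cons[OF Suc.prems(1) that False]) auto
      then show ?thesis using False by (simp add: Let_def)
    qed
    show ?case
      by (intro exI[of _ "spmf_of_set X"] exI[of _ ?step] exI[of _ ?A] conjI unfold prob ballI step)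
         (use assms(1) X in simp_all)
  qed simp_all
  then show ?case by simp
qed

section \<open>Quantum search\<close>

text \<open>The sum telescopes: each summand is 1/2 minus an increment of
  \<open>sin (4 * M * \<theta>) / (4 * sin (2 * \<theta>))\<close>.\<close>

lemma sum_sin_squared_odd:
  fixes \<theta> :: real
  assumes "sin (2 * \<theta>) \<noteq> 0"
  shows "(\<Sum>j<M. (sin (real (2 * j + 1) * \<theta>))\<^sup>2) = real M / 2 - sin (4 * real M * \<theta>) / (4 * sin (2 * \<theta>))"
proof (induction M)
  case 0
  show ?case by simp
next
  case (Suc M)
  define x where "x = real (2 * M + 1) * \<theta>"
  have "sin (4 * real (Suc M) * \<theta>) - sin (4 * real M * \<theta>) = sin (2 * x + 2 * \<theta>) - sin (2 * x - 2 * \<theta>)"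
    by (simp add: x_def algebra_simps)
  also have "\<dots> = 2 * cos (2 * x) * sin (2 * \<theta>)"
    by (simp add: sin_add sin_diff)
  also have "cos (2 * x) = 1 - 2 * (sin x)\<^sup>2"
    by (simp add: cos_double_sin)
  finally have *: "sin (4 * real (Suc M) * \<theta>) = sin (4 * real M * \<theta>) + 2 * (1 - 2 * (sin x)\<^sup>2) * sin (2 * \<theta>)"
    by simp
  show ?case
    unfolding sum.lessThan_Suc Suc.IH x_def[symmetric] * using assms by (simp add: field_simps)
qed

text \<open>The second \<open>query_G\<close> restores the work register because xor with the same
  code cancels; the flip of the result qubit remains.\<close>

lemma query_H_apply:
  "query_H Z G L (\<psi>, n)
    = ((\<lambda>(y, w, b). \<psi> (y, w, b \<noteq> (xor w (code Z (G y)) \<in> code Z ` snd ` set L))), n + 2)"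
  by (auto simp: query_H_def query_G_def lookup_def xor.assoc fun_eq_iff)

text \<open>Search with a fixed table. One Grover iteration rotates the state by
  \<open>2 * \<theta>\<close>, and \<open>m\<^sub>0\<close> is the range of the random iteration
  count from which a round succeeds with probability at least 1/4.\<close>

locale grover_search =
  fixes Y :: "'y set" and Z :: "'z set" and G :: "'y \<Rightarrow> 'z" and L :: "('x \<times> 'z) list" and s :: nat
    and sol :: "'y set" and \<theta> m\<^sub>0 :: real
  defines "sol \<equiv> {y\<in>Y. G y \<in> snd ` set L}"
    and "\<theta> \<equiv> arcsin (sqrt (card sol / card Y))"
    and "m\<^sub>0 \<equiv> 1 / sin (2 * \<theta>)"
  assumes finite_Y: "finite Y" and finite_Z: "finite Z" and G: "G \<in> Y \<rightarrow> Z"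
    and table: "snd ` set L \<subseteq> Z"
    and card_sol_pos: "0 < card sol" and card_sol_le: "2 * card sol \<le> card Y"
begin

section \<open>The rotation angle and the threshold for the iteration count\<close>

lemma card_Y_pos: "0 < card Y"
  using card_sol_pos card_sol_le by simp

lemma sol_subset: "sol \<subseteq> Y"
  by (auto simp: sol_def)

lemma ratio: "0 < card sol / card Y" "card sol / card Y \<le> 1 / 2" "card sol / card Y < 1"
  using card_sol_pos card_sol_le card_Y_pos by (simp_all add: field_simps flip: of_nat_mult)

lemma sqrt_ratio: "- 1 \<le> sqrt (card sol / card Y)" "sqrt (card sol / card Y) \<le> 1"
proof -
  have "0 \<le> sqrt (card sol / card Y)" by simp
  then show "- 1 \<le> sqrt (card sol / card Y)" by linarith
  show "sqrt (card sol / card Y) \<le> 1" using ratio(3) by (intro real_sqrt_le_1_iff[THEN iffD2]) simp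
qed

lemma sin_theta: "sin \<theta> = sqrt (card sol / card Y)"
  unfolding \<theta>_def by (rule sin_arcsin) (rule sqrt_ratio)+

lemma cos_theta: "cos \<theta> = sqrt (1 - card sol / card Y)"
  unfolding \<theta>_def by (subst cos_arcsin) (use sqrt_ratio less_imp_le[OF ratio(1)] less_imp_le[OF ratio(3)] in simp_all)

lemma sin_theta_pos: "0 < sin \<theta>"
  using ratio by (simp add: sin_theta)

lemma cos_theta_pos: "0 < cos \<theta>"
  using ratio by (simp add: cos_theta)

lemma card_sol_eq: "real (card sol) = card Y * (sin \<theta>)\<^sup>2"
  using card_Y_pos by (simp add: sin_theta)

lemma card_nonsol_eq: "real (card (Y - sol)) = card Y * (cos \<theta>)\<^sup>2"
  using card_Y_pos card_mono[OF finite_Y sol_subset] finite_subset[OF sol_subset finite_Y]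
  by (simp add: card_Diff_subset sol_subset of_nat_diff cos_squared_eq card_sol_eq algebra_simps)

text \<open>In \<open>2 * sin \<theta> * cos \<theta>\<close> the last factor is at least
  \<open>sqrt (1 / 2)\<close>, since at most half of \<open>Y\<close> are solutions.\<close>

lemma sin_2theta: "sqrt (2 * card sol / card Y) \<le> sin (2 * \<theta>)" "0 < sin (2 * \<theta>)"
proof -
  have "1 / 2 \<le> 1 - card sol / card Y" using ratio by simp
  then have "sqrt (1 / 2) \<le> cos \<theta>" unfolding cos_theta by (rule real_sqrt_le_mono)
  then have "2 * (sqrt (card sol / card Y) * sqrt (1 / 2)) \<le> sin (2 * \<theta>)"
    using sin_theta_pos by (simp add: sin_double sin_theta)
  moreover have "2 * (sqrt (card sol / card Y) * sqrt (1 / 2)) = sqrt (2 * card sol / card Y)"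
    by (rule real_sqrt_unique[symmetric]) (simp_all add: power_mult_distrib)
  ultimately show "sqrt (2 * card sol / card Y) \<le> sin (2 * \<theta>)" by simp
  show "0 < sin (2 * \<theta>)"
    using sin_theta_pos cos_theta_pos by (simp add: sin_double)
qed

lemma m0_ge_1: "1 \<le> m\<^sub>0"
  using sin_2theta(2) by (simp add: m\<^sub>0_def)

lemma m0_le: "m\<^sub>0 \<le> sqrt (card Y / (2 * card sol))"
proof -
  have "m\<^sub>0 \<le> 1 / sqrt (2 * card sol / card Y)"
    unfolding m\<^sub>0_def using ratio sin_2theta by (intro divide_left_mono) auto
  then show ?thesis by (simp add: real_sqrt_divide)
qed

text \<open>Needed so that the cap \<open>sqrt (card Y)\<close> on \<open>m\<close> in
  \<open>grover_loop\<close> does not lie below the threshold.\<close>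

lemma m0_le_sqrt: "m\<^sub>0 \<le> sqrt (card Y)"
proof -
  have "real (card Y) / (2 * card sol) \<le> card Y / 1"
    using card_sol_pos by (intro divide_left_mono) auto
  then show ?thesis using m0_le by (metis div_by_1 order_trans real_sqrt_le_mono)
qed

section \<open>Grover iterations as rotations\<close>

text \<open>The state stays in the plane spanned by the uniform superpositions of solutions and of
  non-solutions, at angle \<open>(2 * j + 1) * \<theta>\<close>. The divisors are the square roots
  of \<open>card sol\<close> and \<open>card (Y - sol)\<close>.\<close>

definition amp :: "nat \<Rightarrow> 'y \<Rightarrow> real" where
  "amp j y = (if y \<in> sol then sin (real (2 * j + 1) * \<theta>) / (sqrt (card Y) * sin \<theta>)
              else cos (real (2 * j + 1) * \<theta>) / (sqrt (card Y) * cos \<theta>))"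

definition grover_state :: "nat \<Rightarrow> 'y qstate" where
  "grover_state j = (\<lambda>(y, w, b).
     if y \<in> Y \<and> w = 0 then of_real ((if b then - 1 else 1) * amp j y / sqrt 2) else 0)"

lemma sum_sol_cases:
  fixes u v :: real
  shows "(\<Sum>y\<in>Y. if y \<in> sol then u else v) = card Y * ((sin \<theta>)\<^sup>2 * u + (cos \<theta>)\<^sup>2 * v)"
proof -
  have "Y \<inter> sol = sol" "Y \<inter> - sol = Y - sol" using sol_subset by auto
  then show ?thesis
    by (simp add: sum.If_cases finite_Y card_sol_eq card_nonsol_eq algebra_simps)
qed

lemma init_state_eq: "init_state Y = grover_state 0"
  using sin_theta_pos cos_theta_pos
  by (auto simp: init_state_def grover_state_def amp_def fun_eq_iff real_sqrt_mult mult.commute)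

text \<open>Phase kickback: flipping the result qubit negates the amplitudes at the solutions.
  Injectivity of \<open>code Z\<close> on \<open>Z\<close> lets codes be compared instead of
  values.\<close>

lemma query_H_state:
  "query_H Z G L (grover_state j, n) = ((\<lambda>(y, w, b).
     if y \<in> Y \<and> w = 0
     then of_real ((if b then - 1 else 1) * (if y \<in> sol then - amp j y else amp j y) / sqrt 2) else 0), n + 2)"
proof -
  have "code Z (G y) \<in> code Z ` snd ` set L \<longleftrightarrow> y \<in> sol" if "y \<in> Y" for y
    using that G inj_on_to_nat_on[OF countable_finite[OF finite_Z]] table
    by (subst inj_on_image_mem_iff[where B = Z]) (auto simp: sol_def)
  then show ?thesis
    by (auto simp: query_H_apply grover_state_def fun_eq_iff)
qed

text \<open>The sign change followed by inversion about the mean is a rotation by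
  \<open>2 * \<theta>\<close>.\<close>

lemma grover_iteration:
  "(diffusion Y \<circ> query_H Z G L) (grover_state j, n) = (grover_state (Suc j), n + 2)"
proof -
  define x where "x = real (2 * j + 1) * \<theta>"
  define S where "S = (\<Sum>y\<in>Y. if y \<in> sol then - amp j y else amp j y)"
  have "S = (\<Sum>y\<in>Y. if y \<in> sol then - (sin x / (sqrt (card Y) * sin \<theta>)) else cos x / (sqrt (card Y) * cos \<theta>))"
    unfolding S_def amp_def x_def by (intro sum.cong) auto
  also have "\<dots> = sqrt (card Y) * (cos \<theta> * cos x - sin \<theta> * sin x)"
    unfolding sum_sol_cases using sin_theta_pos cos_theta_pos card_Y_pos
    by (simp add: field_simps power2_eq_square)
  finally have S: "S / card Y = (cos \<theta> * cos x - sin \<theta> * sin x) / sqrt (card Y)"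
    using sqrt_divide_self_eq[of "card Y"] by (simp add: divide_inverse mult_ac)
  have Suc_x: "real (2 * Suc j + 1) * \<theta> = x + 2 * \<theta>"
    by (simp add: x_def algebra_simps)
  \<comment> \<open>The double-angle formula for the cosine is used in its sine form on
    \<open>sol\<close> and in its cosine form elsewhere, to match the divisor
    \<open>sin \<theta>\<close> or \<open>cos \<theta>\<close>.\<close>
  have amp_Suc: "2 * (S / card Y) - (if y \<in> sol then - amp j y else amp j y) = amp (Suc j) y" for y
  proof (cases "y \<in> sol")
    case True
    then show ?thesis
      unfolding S amp_def x_def[symmetric] Suc_x sin_add cos_double_sin sin_double
      using sin_theta_pos card_Y_pos by (simp add: field_simps power2_eq_square)
  next
    case False
    then show ?thesis
      unfolding S amp_def x_def[symmetric] Suc_x cos_add cos_double_cos sin_double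
      using cos_theta_pos card_Y_pos by (simp add: field_simps power2_eq_square)
  qed
  have sum: "(\<Sum>y\<in>Y. complex_of_real ((if b then - 1 else 1) * (if y \<in> sol then - amp j y else amp j y) / sqrt 2))
      = of_real ((if b then - 1 else 1) * S / sqrt 2)" for b
    unfolding of_real_sum[symmetric] S_def by (simp add: sum_divide_distrib sum_negf)
  have iter: "2 * complex_of_real (c * S / sqrt 2) / of_nat (card Y)
      - of_real (c * (if y \<in> sol then - amp j y else amp j y) / sqrt 2)
      = of_real (c * amp (Suc j) y / sqrt 2)" for c y
  proof -
    have "2 * (c * S / sqrt 2) / card Y - c * (if y \<in> sol then - amp j y else amp j y) / sqrt 2
        = c * amp (Suc j) y / sqrt 2"
      unfolding amp_Suc[symmetric] using card_Y_pos by (simp add: field_simps)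
    from arg_cong[OF this, of complex_of_real] show ?thesis
      by (simp only: of_real_mult of_real_diff of_real_divide of_real_numeral of_real_of_nat_eq)
  qed
  \<comment> \<open>Diffusion acts separately for each \<open>(w, b)\<close>, and only the slices
    with \<open>w = 0\<close> carry amplitude.\<close>
  have restrict: "(\<Sum>y\<in>Y. if y \<in> Y \<and> w = 0 then h y else 0) = (if w = 0 then \<Sum>y\<in>Y. h y else 0)"
    for w :: nat and h :: "'y \<Rightarrow> complex"
    by (auto intro: sum.cong)
  show ?thesis
  proof (unfold comp_apply query_H_state diffusion_def prod.case, intro arg_cong2[where f = Pair] ext refl, goal_cases)
    case (1 ywb)
    obtain y w b where ywb: "ywb = (y, w, b)" by (cases ywb)
    show ?case
      unfolding ywb prod.case restrict sum grover_state_def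
      by (cases "y \<in> Y"; cases "w = 0")
         (simp_all only: if_True if_False simp_thms iter mult_zero_right div_0 diff_self)
  qed
qed

lemma grover_iterations:
  "((diffusion Y \<circ> query_H Z G L) ^^ j) (init_state Y, n) = (grover_state j, n + 2 * j)"
  by (induction j) (simp_all only: init_state_eq funpow.simps comp_apply grover_iteration[unfolded comp_apply] id_apply, simp_all)

section \<open>Measurement of the query register\<close>

definition grover_measure :: "nat \<Rightarrow> 'y spmf" where
  "grover_measure j = measure_query s (grover_state j)"

lemma grover_run_eq: "grover_run Y s (query_H Z G L) j n = map_spmf (\<lambda>y. (y, n + 2 * j)) (grover_measure j)"
  unfolding grover_run_def grover_iterations grover_measure_def by simp

lemma sum_amp_squared: "(\<Sum>y\<in>Y. (amp j y)\<^sup>2) = 1"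
proof -
  define x where "x = real (2 * j + 1) * \<theta>"
  have "(\<Sum>y\<in>Y. (amp j y)\<^sup>2) = (\<Sum>y\<in>Y. if y \<in> sol then (sin x / (sqrt (card Y) * sin \<theta>))\<^sup>2
      else (cos x / (sqrt (card Y) * cos \<theta>))\<^sup>2)"
    unfolding amp_def x_def by (intro sum.cong) auto
  also have "\<dots> = (sin x)\<^sup>2 + (cos x)\<^sup>2"
    unfolding sum_sol_cases using sin_theta_pos cos_theta_pos card_Y_pos
    by (simp add: power_divide power_mult_distrib field_simps)
  finally show ?thesis by simp
qed

text \<open>The squared amplitudes sum to 1, so \<open>embed_spmf\<close> really has these masses.
  The only contributing work value, 0, lies below \<open>2 ^ s\<close> for every
  \<open>s\<close>.\<close>

lemma spmf_grover_measure: "spmf (grover_measure j) y = (if y \<in> Y then (amp j y)\<^sup>2 else 0)"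
proof -
  have norm: "(\<Sum>b\<in>UNIV. (cmod (grover_state j (y, w, b)))\<^sup>2) = (if w = 0 then if y \<in> Y then (amp j y)\<^sup>2 else 0 else 0)"
    for y w
    by (simp add: grover_state_def UNIV_bool norm_divide norm_mult power_divide)
  have probs: "(\<Sum>w<2 ^ s. \<Sum>b\<in>UNIV. (cmod (grover_state j (y, w, b)))\<^sup>2) = (if y \<in> Y then (amp j y)\<^sup>2 else 0)"
    for y
    unfolding norm by (simp add: sum.delta)
  have "(\<integral>\<^sup>+ y. ennreal (if y \<in> Y then (amp j y)\<^sup>2 else 0) \<partial>count_space UNIV)
      = (\<Sum>y\<in>Y. ennreal ((amp j y)\<^sup>2))"
    using finite_Y by (subst nn_integral_count_space'[where A = Y]) auto
  also have "\<dots> = 1"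
    by (simp add: sum_amp_squared)
  finally show ?thesis
    unfolding grover_measure_def measure_query_def probs by (subst spmf_embed_spmf) auto
qed

lemma set_grover_measure: "set_spmf (grover_measure j) \<subseteq> Y"
  by (auto simp: in_set_spmf_iff_spmf spmf_grover_measure split: if_splits)

lemma measure_grover_measure: "A \<subseteq> Y \<Longrightarrow> measure (measure_spmf (grover_measure j)) A = (\<Sum>y\<in>A. (amp j y)\<^sup>2)"
  by (subst measure_spmf.finite_measure_eq_sum_singleton)
     (auto simp: spmf_conv_measure_spmf[symmetric] spmf_grover_measure finite_subset[OF _ finite_Y] intro!: sum.cong)

lemma lossless_grover_measure: "lossless_spmf (grover_measure j)"
proof -
  have "1 = measure (measure_spmf (grover_measure j)) Y"
    by (simp add: measure_grover_measure sum_amp_squared)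
  also have "\<dots> \<le> weight_spmf (grover_measure j)"
    unfolding weight_spmf_def by (intro measure_spmf.finite_measure_mono) (auto simp: space_measure_spmf)
  finally show ?thesis
    using weight_spmf_le_1[of "grover_measure j"] by (simp add: lossless_spmf_def)
qed

text \<open>All solutions have the same amplitude, and their number
  \<open>card Y * (sin \<theta>)\<^sup>2\<close> cancels the squared divisor.\<close>

lemma measure_sol: "measure (measure_spmf (grover_measure j)) sol = (sin (real (2 * j + 1) * \<theta>))\<^sup>2"
proof -
  have "(\<Sum>y\<in>sol. (amp j y)\<^sup>2) = (\<Sum>y\<in>sol. (sin (real (2 * j + 1) * \<theta>) / (sqrt (card Y) * sin \<theta>))\<^sup>2)"
    by (intro sum.cong) (auto simp: amp_def)
  also have "\<dots> = (sin (real (2 * j + 1) * \<theta>))\<^sup>2"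
    using sin_theta_pos card_Y_pos by (simp add: card_sol_eq power_divide power_mult_distrib)
  finally show ?thesis
    by (simp add: measure_grover_measure sol_subset)
qed

section \<open>One round with a random number of iterations\<close>

text \<open>A round before its classical test; \<open>j\<close> is kept because it determines the
  cost.\<close>

definition round_spmf :: "real \<Rightarrow> (nat \<times> 'y) spmf" where
  "round_spmf m = bind_spmf (spmf_of_set {j. real j < m}) (\<lambda>j. map_spmf (Pair j) (grover_measure j))"

lemma less_real_eq: "{j. real j < m} = {..<nat \<lceil>m\<rceil>}"
  by (auto simp: less_ceiling_iff zless_nat_eq_int_zless)

lemma set_round_spmf: "set_spmf (round_spmf m) \<subseteq> {(j, y). real j < m \<and> y \<in> Y}"
proof -
  have "finite {j. real j < m}" by (simp add: less_real_eq)
  then show ?thesis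
    by (auto simp: round_spmf_def set_bind_spmf dest: set_grover_measure[THEN subsetD])
qed

lemma lossless_round_spmf: "1 \<le> m \<Longrightarrow> lossless_spmf (round_spmf m)"
  by (simp add: round_spmf_def less_real_eq lossless_grover_measure lessThan_empty_iff)

lemma measure_round_spmf:
  "measure (measure_spmf (round_spmf m)) {(j, y). y \<in> sol}
    = (\<Sum>j<nat \<lceil>m\<rceil>. (sin (real (2 * j + 1) * \<theta>))\<^sup>2) / real (nat \<lceil>m\<rceil>)"
proof -
  have "measure (measure_spmf (map_spmf (Pair j) (grover_measure j))) {(j, y). y \<in> sol}
      = (sin (real (2 * j + 1) * \<theta>))\<^sup>2" for j
    unfolding measure_sol[symmetric] by (simp add: measure_map_spmf vimage_def)
  then show ?thesis
    unfolding round_spmf_def measure_spmf_bind less_real_eq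
    by (subst measure_spmf.measure_bind[where N = "count_space UNIV"])
       (simp_all add: space_subprob_algebra integral_spmf_of_set)
qed

text \<open>The average over \<open>j < M\<close> is 1/2 minus
  \<open>sin (4 * M * \<theta>) / (4 * M * sin (2 * \<theta>))\<close>, and
  \<open>M \<ge> m\<^sub>0\<close> makes the subtracted term at most 1/4.\<close>

lemma measure_round_spmf_ge:
  assumes "m\<^sub>0 \<le> m"
  shows "1 / 4 \<le> measure (measure_spmf (round_spmf m)) {(j, y). y \<in> sol}"
proof -
  define M where "M = real (nat \<lceil>m\<rceil>)"
  have M: "m\<^sub>0 \<le> M" using assms real_nat_ceiling_ge[of m] by (simp add: M_def)
  have "sin (4 * M * \<theta>) / (4 * sin (2 * \<theta>)) \<le> 1 / (4 * sin (2 * \<theta>))"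
    using sin_2theta(2) by (intro divide_right_mono) auto
  also have "\<dots> \<le> M / 4"
    using M by (simp add: m\<^sub>0_def)
  finally have "M / 4 \<le> (\<Sum>j<nat \<lceil>m\<rceil>. (sin (real (2 * j + 1) * \<theta>))\<^sup>2)"
    using sin_2theta(2) by (subst sum_sin_squared_odd) (auto simp: M_def)
  then show ?thesis
    unfolding measure_round_spmf M_def[symmetric] using M m0_ge_1 by (simp add: field_simps)
qed

text \<open>Only the term \<open>j = 0\<close> is kept. The bound is uniform in \<open>m\<close> and
  covers \<open>m < m\<^sub>0\<close> too, as almost sure termination requires.\<close>

lemma measure_round_spmf_pos:
  assumes "1 \<le> m" "m \<le> sqrt (card Y)"
  shows "(sin \<theta>)\<^sup>2 / (sqrt (card Y) + 1) \<le> measure (measure_spmf (round_spmf m)) {(j, y). y \<in> sol}"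
proof -
  have "(sin \<theta>)\<^sup>2 \<le> (\<Sum>j<nat \<lceil>m\<rceil>. (sin (real (2 * j + 1) * \<theta>))\<^sup>2)"
    using assms(1) member_le_sum[of 0 "{..<nat \<lceil>m\<rceil>}" "\<lambda>j. (sin (real (2 * j + 1) * \<theta>))\<^sup>2"] by simp
  moreover have "real (nat \<lceil>m\<rceil>) \<le> sqrt (card Y) + 1" "0 < real (nat \<lceil>m\<rceil>)"
    using assms by linarith+
  ultimately show ?thesis
    unfolding measure_round_spmf by (intro frac_le) (auto intro: sum_nonneg)
qed

section \<open>The search loop\<close>

text \<open>\<open>loop\<close> is an arbitrary continuation here, so that the equation serves both
  the approximants in fixed-point induction and the loop itself. A round costs two evaluations per
  iteration and one for the test.\<close>

lemma grover_loop_body: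
  "bind_spmf (spmf_of_set {j. real j < m}) (\<lambda>j.
     bind_spmf (grover_run Y s (query_H Z G L) j n) (\<lambda>(y, n').
     case eval_H G L y n' of (success, n'') \<Rightarrow>
       if success then return_spmf (y, n'') else loop n''))
   = bind_spmf (round_spmf m) (\<lambda>(j, y). if y \<in> sol then return_spmf (y, n + 2 * j + 1) else loop (n + 2 * j + 1))"
proof -
  have "bind_spmf (grover_run Y s (query_H Z G L) j n) (\<lambda>(y, n').
       case eval_H G L y n' of (success, n'') \<Rightarrow> if success then return_spmf (y, n'') else loop n'')
     = bind_spmf (grover_measure j)
         (\<lambda>y. if y \<in> sol then return_spmf (y, n + 2 * j + 1) else loop (n + 2 * j + 1))" for j
    unfolding grover_run_eq bind_map_spmf
    by (rule bind_spmf_cong) (use set_grover_measure in \<open>auto simp: eval_H_def sol_def\<close>)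
  then show ?thesis
    by (simp add: round_spmf_def bind_spmf_assoc bind_map_spmf o_def)
qed

abbreviation "loop \<equiv> grover_loop Y s (query_H Z G L) (eval_H G L)"

lemma set_grover_loop: "set_spmf (loop m n) \<subseteq> {(y, n). y \<in> sol}"
proof (induction arbitrary: m n rule: grover_loop.fixp_induct)
  case 1
  show ?case by simp
next
  case 2
  show ?case by simp
next
  case (3 gl)
  show ?case
    unfolding grover_loop_body using 3 by (fastforce simp: set_bind_spmf split: if_splits)
qed

text \<open>While \<open>m < m\<^sub>0\<close> the costs of the rounds form a geometric series of ratio \<open>6/5\<close>; afterwards a
  round fails with probability at most \<open>3/4\<close>, and \<open>3/4 * 6/5 = 9/10 < 1\<close>. The potential is the
  corresponding solution of the recurrence for the expected remaining cost, where a round costs at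
  most \<open>3 * m\<close>.\<close>

definition potential :: "real \<Rightarrow> real" where
  "potential m = (if m\<^sub>0 \<le> m then 30 * m else 54 * m\<^sub>0 - 15 * m)"

lemma grover_loop_evals_le:
  "1 \<le> m \<Longrightarrow> (\<integral>\<^sup>+ (y, n'). of_nat n' \<partial>measure_spmf (loop m n)) \<le> ennreal (real n + potential m)"
proof (induction arbitrary: m n rule: grover_loop.fixp_induct)
  case 1
  show ?case by simp
next
  case 2
  show ?case by simp
next
  case (3 gl)
  let ?m' = "min (6 / 5 * m) (sqrt (card Y))"
  let ?next = "\<lambda>(j, y). if y \<in> sol then return_spmf (y, n + 2 * j + 1)
    else gl Y s (query_H Z G L) (eval_H G L) ?m' (n + 2 * j + 1)"
  \<comment> \<open>\<open>U\<close> bounds the potential after the update of \<open>m\<close>. If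
    the update crosses the threshold, this reads
    \<open>36 * m \<le> 54 * m\<^sub>0 - 18 * m\<close>, which holds as \<open>m < m\<^sub>0\<close>
    and explains the 54.\<close>
  define U where "U = (if m\<^sub>0 \<le> m then 36 * m else 54 * m\<^sub>0 - 18 * m)"
  define q :: real where "q = (if m\<^sub>0 \<le> m then 3 / 4 else 1)"
  have m': "1 \<le> ?m'" using \<open>1 \<le> m\<close> card_Y_pos by simp
  have U: "potential ?m' \<le> U" "0 \<le> U"
    using \<open>1 \<le> m\<close> m0_le_sqrt by (auto simp: potential_def U_def min_def)
  have pot0: "0 \<le> potential ?m'"
    using m' m0_ge_1 by (auto simp: potential_def)
  have "measure (measure_spmf (round_spmf m)) (- {(j, y). y \<in> sol}) \<le> q"
  proof -
    have "measure (measure_spmf (round_spmf m)) (- {(j, y). y \<in> sol})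
        = 1 - measure (measure_spmf (round_spmf m)) {(j, y). y \<in> sol}"
      using measure_spmf.finite_measure_compl[of "{(j, y). y \<in> sol}" "round_spmf m"]
        lossless_round_spmf[OF \<open>1 \<le> m\<close>]
      by (simp add: space_measure_spmf Compl_eq_Diff_UNIV lossless_spmf_def weight_spmf_def)
    then show ?thesis
      using measure_round_spmf_ge[of m] by (auto simp: q_def)
  qed
  then have "(\<integral>\<^sup>+ jy. (\<integral>\<^sup>+ (y, n'). of_nat n' \<partial>measure_spmf (?next jy)) \<partial>measure_spmf (round_spmf m))
      \<le> ennreal (real n + 3 * m + (real n + 3 * m + U - (real n + 3 * m)) * q)"
  proof (rule nn_integral_spmf_le_two_values[rotated])
    fix jy assume "jy \<in> set_spmf (round_spmf m)"
    then obtain j y where jy: "jy = (j, y)" "real j < m"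
      using set_round_spmf by blast
    have j: "real (n + 2 * j + 1) \<le> real n + 3 * m" using jy(2) \<open>1 \<le> m\<close> by simp
    have "(\<integral>\<^sup>+ (y, n'). of_nat n' \<partial>measure_spmf (gl Y s (query_H Z G L) (eval_H G L) ?m' (n + 2 * j + 1)))
        \<le> ennreal (real (n + 2 * j + 1) + potential ?m')"
      by (rule 3(1)[OF m'])
    also have "\<dots> \<le> ennreal (real n + 3 * m + U)"
      using j U by (intro ennreal_leI) simp
    finally show "(\<integral>\<^sup>+ (y, n'). of_nat n' \<partial>measure_spmf (?next jy))
        \<le> ennreal (if jy \<in> - {(j, y). y \<in> sol} then real n + 3 * m + U else real n + 3 * m)"
      using ennreal_leI[OF j]
      by (simp add: jy nn_integral_return_spmf ennreal_of_nat_eq_real_of_nat del: of_nat_add of_nat_Suc ennreal_plus)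
  qed (use \<open>1 \<le> m\<close> U in auto)
  \<comment> \<open>Above the threshold \<open>3 + 36 * 3/4 = 30\<close>; below it failure is
    bounded only by 1, and \<open>3 - 18 = -15\<close>.\<close>
  also have "real n + 3 * m + (real n + 3 * m + U - (real n + 3 * m)) * q = real n + potential m"
    by (simp add: U_def q_def potential_def)
  finally show ?case
    unfolding grover_loop_body nn_integral_bind_spmf .
qed

text \<open>The update of \<open>m\<close> preserves \<open>1 \<le> m \<le> sqrt (card Y)\<close>,
  under which every round succeeds with at least one fixed positive probability.\<close>

lemma lossless_grover_loop:
  assumes "1 \<le> m" "m \<le> sqrt (card Y)"
  shows "lossless_spmf (loop m n)"
proof -
  let ?loop = "\<lambda>(m, n). loop m n"
  let ?I = "\<lambda>(m, n :: nat). 1 \<le> m \<and> m \<le> sqrt (card Y)"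
  let ?A = "{(j, y). y \<in> sol} :: (nat \<times> 'y) set"
  have "lossless_spmf (?loop (m, n))"
  proof (rule lossless_spmf_loop[where 'b = "nat \<times> 'y" and loop = ?loop and I = ?I
        and p = "(sin \<theta>)\<^sup>2 / (sqrt (card Y) + 1)"], goal_cases)
    case (1 mn)
    obtain m n where mn: "mn = (m, n)" by force
    let ?next = "\<lambda>(j, y). if y \<in> sol then return_spmf (y, n + 2 * j + 1)
      else loop (min (6 / 5 * m) (sqrt (card Y))) (n + 2 * j + 1)"
    have m: "1 \<le> m" "m \<le> sqrt (card Y)" using 1 by (auto simp: mn)
    have unfold: "?loop mn = bind_spmf (round_spmf m) ?next"
      unfolding mn prod.case by (subst grover_loop.simps) (rule grover_loop_body)
    have step: "if jy \<in> ?A then lossless_spmf (?next jy) else \<exists>s'. ?I s' \<and> ?next jy = ?loop s'" for jy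
      using m card_Y_pos by (cases jy) (auto simp: Suc_le_eq intro!: exI[of _ "min (6 / 5 * m) (sqrt (card Y))"])
    show ?case
      by (intro exI[of _ "round_spmf m"] exI[of _ ?next] exI[of _ ?A] conjI unfold ballI step
          lossless_round_spmf measure_round_spmf_pos m)
  qed (use assms sin_theta_pos card_Y_pos in \<open>auto intro!: divide_pos_pos add_nonneg_pos\<close>)
  then show ?thesis by simp
qed

lemma grover_correct:
  "lossless_spmf (grover Y s (query_H Z G L) (eval_H G L))"
  "set_spmf (grover Y s (query_H Z G L) (eval_H G L)) \<subseteq> {(y, n). y \<in> sol}"
  "(\<integral>\<^sup>+ (y, n). of_nat n \<partial>measure_spmf (grover Y s (query_H Z G L) (eval_H G L)))
    \<le> ennreal (54 * sqrt (card Y / (2 * card sol)))"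
proof -
  show "lossless_spmf (grover Y s (query_H Z G L) (eval_H G L))"
    unfolding grover_def using card_Y_pos by (intro lossless_grover_loop) auto
  show "set_spmf (grover Y s (query_H Z G L) (eval_H G L)) \<subseteq> {(y, n). y \<in> sol}"
    unfolding grover_def by (rule set_grover_loop)
  \<comment> \<open>As \<open>1 \<le> m\<^sub>0\<close>, this potential is
    \<open>54 * m\<^sub>0 - 15\<close>, or 30 if \<open>m\<^sub>0 = 1\<close>.\<close>
  have "potential 1 \<le> 54 * sqrt (card Y / (2 * card sol))"
    using m0_ge_1 m0_le by (auto simp: potential_def)
  then show "(\<integral>\<^sup>+ (y, n). of_nat n \<partial>measure_spmf (grover Y s (query_H Z G L) (eval_H G L)))
      \<le> ennreal (54 * sqrt (card Y / (2 * card sol)))"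
    unfolding grover_def
    using grover_loop_evals_le[of 1 0] by (auto elim!: order_trans intro: ennreal_leI)
qed

end

section \<open>Finding a claw\<close>

lemma find_snd_Some:
  assumes "z \<in> snd ` set L"
  obtains x where "find (\<lambda>p. snd p = z) L = Some (x, z)" "(x, z) \<in> set L"
proof (cases "find (\<lambda>p. snd p = z) L")
  case None
  then show ?thesis using assms by (auto simp: find_None_iff)
next
  case (Some p)
  then have "snd p = z" "p \<in> set L" by (auto simp: find_Some_iff)
  then show ?thesis using that Some by (cases p) auto
qed

text \<open>The assumptions on the table concern only \<open>set L\<close>, so they survive
  sorting.\<close>

lemma search_with_table:
  fixes X :: "'x set" and Y :: "'y set" and Z :: "'z set" and L :: "('x \<times> 'z) list" and nF s :: nat
  assumes "finite X" "finite Y" "finite Z" "F \<in> X \<rightarrow> Z" "G ` Y = Z" "r_to_one r G Y" "0 < r"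
    and k: "1 \<le> k" "2 * k \<le> card Z"
    and L: "card (snd ` set L) = k" "set L \<subseteq> (\<lambda>x. (x, F x)) ` X"
  defines "search \<equiv> bind_spmf (grover Y (width Z) (query_H Z G L) (eval_H G L)) (\<lambda>(y\<^sub>0, nG).
     let z = G y\<^sub>0 in
     case find (\<lambda>p. snd p = z) L of
       None \<Rightarrow> return_pmf None
     | Some (x\<^sub>0, _) \<Rightarrow> return_spmf (Outcome (x\<^sub>0, y\<^sub>0) nF (Suc nG) s))"
  shows "lossless_spmf search"
    and "\<And>out. out \<in> set_spmf search \<Longrightarrow> is_claw X Y F G (claw out) \<and> evals_F out = nF \<and> table_space out = s"
    and "expected search evals_G \<le> ennreal (55 * sqrt (card Z / real k))"
proof -
  define sol where "sol = {y\<in>Y. G y \<in> snd ` set L}"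
  let ?grover = "grover Y (width Z) (query_H Z G L) (eval_H G L)"
  have table: "snd ` set L \<subseteq> Z" using assms(4) L(2) by fastforce
  have card_sol: "card sol = r * k"
    unfolding sol_def using r_to_one_card_vimage[OF assms(6,2), of "snd ` set L"] table assms(5) L(1) by simp
  have "{y\<in>Y. G y \<in> G ` Y} = Y" by auto
  then have card_Y: "card Y = r * card Z"
    using r_to_one_card_vimage[OF assms(6,2) order_refl] assms(5) by simp
  have "grover_search Y Z G L"
    using assms(2,3,5,7) k table card_sol unfolding sol_def
    by unfold_locales (auto simp: card_Y)
  note grover = grover_search.grover_correct[OF this, of "width Z", folded sol_def]
  \<comment> \<open>On the support of the search \<open>find\<close> succeeds, so the failing branch
    is never taken and \<open>search\<close> is an image of the search distribution.\<close>
  define h where "h = (\<lambda>(y\<^sub>0, nG). Outcome (fst (the (find (\<lambda>p. snd p = G y\<^sub>0) L)), y\<^sub>0) nF (Suc nG) s)"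
  have search: "search = map_spmf h ?grover"
    unfolding search_def map_spmf_conv_bind_spmf
  proof (rule bind_spmf_cong[OF refl], goal_cases)
    case (1 yn)
    obtain y n where yn: "yn = (y, n)" by (cases yn)
    have "G y \<in> snd ` set L" using subsetD[OF grover(2) 1] by (simp add: yn sol_def)
    then show ?case by (auto simp: yn h_def elim!: find_snd_Some)
  qed
  show "lossless_spmf search" by (simp add: search grover(1))
  show "is_claw X Y F G (claw out) \<and> evals_F out = nF \<and> table_space out = s" if mem: "out \<in> set_spmf search" for out
  proof -
    obtain y n where out: "out = h (y, n)" and "(y, n) \<in> set_spmf ?grover" using mem by (auto simp: search)
    from subsetD[OF grover(2) this(2)] have y: "y \<in> sol" by simp
    then obtain x where "find (\<lambda>p. snd p = G y) L = Some (x, G y)" "(x, G y) \<in> set L"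
      by (auto simp: sol_def elim!: find_snd_Some)
    then show ?thesis using L(2) y by (auto simp: out h_def is_claw_def sol_def)
  qed
  have ratio: "card Y / (2 * card sol) \<le> card Z / real k" "1 \<le> card Z / real k"
    using assms(7) k by (auto simp: card_Y card_sol field_simps simp flip: of_nat_mult)
  have "expected search evals_G = (\<integral>\<^sup>+ yn. 1 + (case yn of (y, n) \<Rightarrow> of_nat n) \<partial>measure_spmf ?grover)"
    unfolding expected_def search map_spmf_conv_bind_spmf nn_integral_bind_spmf
    by (intro nn_integral_cong) (auto simp: nn_integral_return_spmf h_def)
  also have "\<dots> = (\<integral>\<^sup>+ yn. 1 \<partial>measure_spmf ?grover) + (\<integral>\<^sup>+ (y, n). of_nat n \<partial>measure_spmf ?grover)"
    by (rule nn_integral_add) auto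
  also have "\<dots> \<le> 1 + ennreal (54 * sqrt (card Y / (2 * card sol)))"
    by (intro add_mono grover(3) nn_integral_spmf_le_const) simp
  also have "\<dots> = ennreal (1 + 54 * sqrt (card Y / (2 * card sol)))"
    by (simp add: ennreal_1[symmetric] del: ennreal_1)
  also have "\<dots> \<le> ennreal (55 * sqrt (card Z / real k))"
  proof (rule ennreal_leI)
    have "sqrt (card Y / (2 * card sol)) \<le> sqrt (card Z / real k)" "1 \<le> sqrt (card Z / real k)"
      using ratio by (simp_all only: real_sqrt_le_iff real_sqrt_ge_1_iff)
    then show "1 + 54 * sqrt (card Y / (2 * card sol)) \<le> 55 * sqrt (card Z / real k)" by linarith
  qed
  finally show "expected search evals_G \<le> ennreal (55 * sqrt (card Z / real k))" .
qed

text \<open>The search bounds hold for every table that can be built, hence also after averaging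
  over tables; the evaluations of \<open>F\<close> are settled by the table stage alone.\<close>

lemma Claw_bounds:
  fixes X :: "'x set" and Y :: "'y set" and Z :: "'z set"
  assumes "finite X" "finite Y" "finite Z" "F ` X = Z" "G ` Y = Z" "r_to_one r F X" "r_to_one r G Y" "0 < r"
    and k: "1 \<le> k" "2 * k \<le> card Z"
  shows "lossless_spmf (Claw X Y Z F G k)"
    and "\<And>out. out \<in> set_spmf (Claw X Y Z F G k) \<Longrightarrow> is_claw X Y F G (claw out) \<and> k \<le> evals_F out \<and> table_space out = k"
    and "expected (Claw X Y Z F G k) evals_F \<le> ennreal (2 * real k)"
    and "expected (Claw X Y Z F G k) evals_G \<le> ennreal (55 * sqrt (card Z / real k))"
proof -
  let ?table = "build_table X F k [] 0 0"
  define rest :: "('x \<times> 'z) list \<times> nat \<times> nat \<Rightarrow> ('x, 'y) outcome spmf" where "rest = (\<lambda>(L\<^sub>0, nF, s).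
     let L = sort_key (\<lambda>p. code Z (snd p)) L\<^sub>0 in
     bind_spmf (grover Y (width Z) (query_H Z G L) (eval_H G L)) (\<lambda>(y\<^sub>0, nG).
     let z = G y\<^sub>0 in
     case find (\<lambda>p. snd p = z) L of
       None \<Rightarrow> return_pmf None
     | Some (x\<^sub>0, _) \<Rightarrow> return_spmf (Outcome (x\<^sub>0, y\<^sub>0) nF (Suc nG) s)))"
  have Claw: "Claw X Y Z F G k = bind_spmf ?table rest"
    by (simp add: Claw_def rest_def)
  have rest:
    "lossless_spmf (rest T)"
    "\<And>out. out \<in> set_spmf (rest T) \<Longrightarrow> is_claw X Y F G (claw out) \<and> evals_F out = fst (snd T) \<and> table_space out = k"
    "expected (rest T) evals_G \<le> ennreal (55 * sqrt (card Z / real k))"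
    "k \<le> fst (snd T)"
    if "T \<in> set_spmf ?table" for T
  proof -
    obtain L\<^sub>0 nF s where T: "T = (L\<^sub>0, nF, s)" by (cases T)
    have valid: "valid_table X F L\<^sub>0" "length L\<^sub>0 = k" "s = k" "k \<le> nF"
      using that set_build_table[OF valid_table_Nil _ _ assms(1), of 0 k F 0] by (auto simp: T)
    let ?L = "sort_key (\<lambda>p. code Z (snd p)) L\<^sub>0"
    have L: "card (snd ` set ?L) = k" "set ?L \<subseteq> (\<lambda>x. (x, F x)) ` X"
      using valid valid_table_card[of X F L\<^sub>0] by (auto simp: valid_table_def)
    have F: "F \<in> X \<rightarrow> Z" using assms(4) by auto
    note search = search_with_table[OF assms(1-3) F assms(5,7,8) k L, where nF = nF and s = s]
    show "lossless_spmf (rest T)" "expected (rest T) evals_G \<le> ennreal (55 * sqrt (card Z / real k))"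
      "k \<le> fst (snd T)"
      using search(1,3) valid(4) by (simp_all add: rest_def T Let_def)
    show "is_claw X Y F G (claw out) \<and> evals_F out = fst (snd T) \<and> table_space out = k"
      if "out \<in> set_spmf (rest T)" for out
      using that search(2) valid(3) unfolding rest_def T prod.case Let_def by auto
  qed
  have k': "2 * k \<le> card (F ` X)" using k assms(4) by simp
  show "lossless_spmf (Claw X Y Z F G k)"
    using lossless_build_table[OF assms(1,6,8) k' valid_table_Nil] rest(1) by (simp add: Claw)
  show "is_claw X Y F G (claw out) \<and> k \<le> evals_F out \<and> table_space out = k"
    if "out \<in> set_spmf (Claw X Y Z F G k)" for out
    using that rest(2,4) by (fastforce simp: Claw set_bind_spmf)
  have "expected (Claw X Y Z F G k) evals_F \<le> (\<integral>\<^sup>+ (L, n, s). of_nat n \<partial>measure_spmf ?table)"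
    unfolding expected_def Claw nn_integral_bind_spmf
    by (rule nn_integral_mono_AE) (auto intro!: nn_integral_spmf_le_const dest: rest(2))
  also have "\<dots> \<le> ennreal (2 * real k)"
    using build_table_evals_le[OF valid_table_Nil _ assms(1,6,8) k', of 0 0] by simp
  finally show "expected (Claw X Y Z F G k) evals_F \<le> ennreal (2 * real k)" .
  show "expected (Claw X Y Z F G k) evals_G \<le> ennreal (55 * sqrt (card Z / real k))"
    unfolding expected_def Claw nn_integral_bind_spmf
    by (rule nn_integral_spmf_le_const) (rule rest(3)[unfolded expected_def])
qed

text \<open>As the root and \<open>k\<close> are both at least 1, rounding changes the root by at
  most a factor 2.\<close>

lemma near_cube_root:
  assumes z: "1 \<le> z" and k: "1 \<le> k" "int k \<in> {\<lfloor>root 3 z\<rfloor>, \<lceil>root 3 z\<rceil>}"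
  shows "real k \<le> 2 * root 3 z" "root 3 z \<le> 2 * real k" "sqrt (z / real k) \<le> 2 * root 3 z"
proof -
  define \<rho> where "\<rho> = root 3 z"
  have "real k = of_int \<lfloor>\<rho>\<rfloor> \<or> real k = of_int \<lceil>\<rho>\<rceil>"
    using k(2) by (metis \<rho>_def empty_iff insert_iff of_int_of_nat_eq)
  then have "real k < \<rho> + 1" "\<rho> < real k + 1"
    using floor_correct[of \<rho>] ceiling_correct[of \<rho>] by linarith+
  moreover have \<rho>: "1 \<le> \<rho>" using z by (simp add: \<rho>_def)
  ultimately show kr: "real k \<le> 2 * root 3 z" "root 3 z \<le> 2 * real k"
    using k(1) unfolding \<rho>_def[symmetric] by linarith+
  have "z = \<rho> ^ 3" by (simp add: \<rho>_def odd_real_root_pow)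
  also have "\<dots> \<le> 4 * \<rho>\<^sup>2 * real k"
    using kr(2) \<rho> k(1) by (simp add: \<rho>_def power3_eq_cube power2_eq_square)
  finally have "z / real k \<le> (2 * \<rho>)\<^sup>2"
    using k(1) by (simp add: field_simps power_mult_distrib)
  then show "sqrt (z / real k) \<le> 2 * root 3 z"
    using \<rho> by (intro real_le_lsqrt) (auto simp: \<rho>_def)
qed

theorem theorem5:
  shows "\<exists>c C :: real. c > 0 \<and> C > 0 \<and>
    (\<forall>(r :: nat) (N :: nat) (k :: nat) (X :: 'x set) (Y :: 'y set) (Z :: 'z set)
       (F :: 'x \<Rightarrow> 'z) (G :: 'y \<Rightarrow> 'z).
      2 \<le> r \<and> finite X \<and> finite Y \<and> finite Z \<and>
      F \<in> X \<rightarrow> Z \<and> G \<in> Y \<rightarrow> Z \<and> r_to_one r F X \<and> r_to_one r G Y \<and>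
      N = card X \<and> N = card Y \<and> N = r * card Z \<and>
      1 \<le> k \<and> real k \<le> real N / (2 * real r) \<longrightarrow>
        lossless_spmf (Claw X Y Z F G k) \<and>
        (\<forall>out\<in>set_spmf (Claw X Y Z F G k). is_claw X Y F G (claw out)) \<and>
        ennreal (c * real k) \<le> expected (Claw X Y Z F G k) evals_F \<and>
        expected (Claw X Y Z F G k) evals_F \<le> ennreal (C * real k) \<and>
        expected (Claw X Y Z F G k) evals_G \<le> ennreal (C * sqrt (real N / (real r * real k))) \<and>
        (\<forall>out\<in>set_spmf (Claw X Y Z F G k).
           c * real k \<le> real (table_space out) \<and> real (table_space out) \<le> C * real k) \<and>
        (int k \<in> {\<lfloor>root 3 (real N / real r)\<rfloor>, \<lceil>root 3 (real N / real r)\<rceil>} \<longrightarrow>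
           expected (Claw X Y Z F G k) (\<lambda>out. evals_F out + evals_G out)
             \<le> ennreal (C * root 3 (real N / real r)) \<and>
           (\<forall>out\<in>set_spmf (Claw X Y Z F G k).
              c * root 3 (real N / real r) \<le> real (table_space out) \<and>
              real (table_space out) \<le> C * root 3 (real N / real r))))"
proof -
  \<comment> \<open>\<open>114 = 2 * 2 + 55 * 2\<close> combines the bounds for \<open>F\<close> and
    \<open>G\<close> with the factors 2 from rounding; 1/2 comes from
    \<open>root 3 z \<le> 2 * k\<close>.\<close>
  let ?c = "1 / 2 :: real" and ?C = "114 :: real"
  have main: "lossless_spmf (Claw X Y Z F G k) \<and>
        (\<forall>out\<in>set_spmf (Claw X Y Z F G k). is_claw X Y F G (claw out)) \<and>
        ennreal (?c * real k) \<le> expected (Claw X Y Z F G k) evals_F \<and>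
        expected (Claw X Y Z F G k) evals_F \<le> ennreal (?C * real k) \<and>
        expected (Claw X Y Z F G k) evals_G \<le> ennreal (?C * sqrt (real N / (real r * real k))) \<and>
        (\<forall>out\<in>set_spmf (Claw X Y Z F G k).
           ?c * real k \<le> real (table_space out) \<and> real (table_space out) \<le> ?C * real k) \<and>
        (int k \<in> {\<lfloor>root 3 (real N / real r)\<rfloor>, \<lceil>root 3 (real N / real r)\<rceil>} \<longrightarrow>
           expected (Claw X Y Z F G k) (\<lambda>out. evals_F out + evals_G out)
             \<le> ennreal (?C * root 3 (real N / real r)) \<and>
           (\<forall>out\<in>set_spmf (Claw X Y Z F G k).
              ?c * root 3 (real N / real r) \<le> real (table_space out) \<and>
              real (table_space out) \<le> ?C * root 3 (real N / real r)))"
    if "2 \<le> r \<and> finite X \<and> finite Y \<and> finite Z \<and>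
      F \<in> X \<rightarrow> Z \<and> G \<in> Y \<rightarrow> Z \<and> r_to_one r F X \<and> r_to_one r G Y \<and>
      N = card X \<and> N = card Y \<and> N = r * card Z \<and>
      1 \<le> k \<and> real k \<le> real N / (2 * real r)"
    for r N k and X :: "'x set" and Y :: "'y set" and Z :: "'z set" and F :: "'x \<Rightarrow> 'z" and G :: "'y \<Rightarrow> 'z"
  proof -
    let ?p = "Claw X Y Z F G k"
    have r: "0 < r" and fin: "finite X" "finite Y" "finite Z"
      and r1: "r_to_one r F X" "r_to_one r G Y" and k: "1 \<le> k"
      using that by auto
    have "real N = real r * real (card Z)" using that of_nat_mult by metis
    then have ratio: "real N / real r = card Z" "real N / (real r * real k) = card Z / real k"
      "real N / (2 * real r) = card Z / 2"
      using r by simp_all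
    have "real k \<le> card Z / 2" using that ratio(3) by argo
    then have k2: "2 * k \<le> card Z" by linarith
    have surj: "F ` X = Z" "G ` Y = Z"
      using that r_to_one_image_eq[OF r1(1) fin(1,3) _ _ r] r_to_one_image_eq[OF r1(2) fin(2,3) _ _ r]
      by simp_all
    note bounds = Claw_bounds[OF fin surj r1 r k k2]
    \<comment> \<open>Every outcome has at least \<open>k\<close> evaluations of \<open>F\<close>,
      and almost sure termination carries this to the mean.\<close>
    have "ennreal (?c * real k) \<le> expected ?p evals_F"
      unfolding expected_def using bounds(1,2)
      by (intro nn_integral_lossless_spmf_ge_const)
         (auto simp: ennreal_of_nat_eq_real_of_nat intro!: ennreal_leI dest!: bounds(2))
    moreover have "expected ?p evals_F \<le> ennreal (?C * real k)"
      by (rule order_trans[OF bounds(3)]) (auto intro: ennreal_leI)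
    moreover have "expected ?p evals_G \<le> ennreal (?C * sqrt (real N / (real r * real k)))"
      unfolding ratio by (rule order_trans[OF bounds(4)]) (auto intro: ennreal_leI)
    moreover have "expected ?p (\<lambda>out. evals_F out + evals_G out) \<le> ennreal (?C * root 3 (card Z))"
      "?c * root 3 (card Z) \<le> real k" "real k \<le> ?C * root 3 (card Z)"
      if "int k \<in> {\<lfloor>root 3 (real (card Z))\<rfloor>, \<lceil>root 3 (real (card Z))\<rceil>}"
    proof -
      have "1 \<le> real (card Z)" using k k2 by linarith
      note near = near_cube_root[OF this k that]
      have "expected ?p (\<lambda>out. evals_F out + evals_G out) = expected ?p evals_F + expected ?p evals_G"
        unfolding expected_def by (simp add: nn_integral_add)
      also have "\<dots> \<le> ennreal (2 * real k) + ennreal (55 * sqrt (card Z / real k))"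
        by (intro add_mono bounds)
      also have "\<dots> = ennreal (2 * real k + 55 * sqrt (card Z / real k))"
        by (rule ennreal_plus[symmetric]) auto
      also have "\<dots> \<le> ennreal (?C * root 3 (card Z))"
        using near by (intro ennreal_leI) linarith
      finally show "expected ?p (\<lambda>out. evals_F out + evals_G out) \<le> ennreal (?C * root 3 (card Z))" .
      show "?c * root 3 (card Z) \<le> real k" "real k \<le> ?C * root 3 (card Z)"
        using near by auto
    qed
    ultimately show ?thesis
      using bounds(1) by (auto simp: ratio(1) dest!: bounds(2))
  qed
  show ?thesis
    by (rule exI[of _ ?c], rule exI[of _ ?C], intro conjI allI impI main) simp_all
qed

end
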